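(* Let $\alpha\in(0,\infty)$, let $X$ be a log-concave random variable on $\mathbb{Z}$, and for $p\in(0,1)$ let $Z_p$ be a geometric random variable with parameter $p$. Then $$H_\alpha(X)-H_\infty(X)\;<\;\lim_{p\to 0}\bigl(H_\alpha(Z_p)-H_\infty(Z_p)\bigr)\;=\;\log\alpha^{\frac{1}{\alpha-1}}.$$
   Context: A $\mathbb{Z}$-valued random variable $X$ is log-concave if the sequence $p_n=\mathbb{P}(X=n)$, $n\in\mathbb{Z}$, satisfies $p_n^2\ge p_{n-1}p_{n+1}$ for all $n\in\mathbb{Z}$ and its support $\{n:p_n>0\}$ is a contiguous interval of integers (whenever $a\le b$ are in the support, so is every integer between $a$ and $b$). Rényi entropy: for a $\mathbb{Z}$-valued random variable $X$ with $p_n=\mathbb{P}(X=n)$ and $\alpha\in(0,1)\cup(1,\infty)$, $H_\alpha(X)=\frac{1}{1-\alpha}\log\sum_{n:p_n>0}p_n^\alpha$; $H_1(X)=-\sum_{n:p_n>0}p_n\log p_n$ (Shannon entropy); $H_\infty(X)=-\log\sup_n p_n$. The geometric random variable $Z_p$ with parameter $p$ has $\mathbb{P}(Z_p=n)=p(1-p)^n$ for $n=0,1,2,\dots$. Convention: for $\alpha=1$, $\alpha^{\frac1{\alpha-1}}$ is interpreted as its limit $e$. Here $\log$ is the logarithm to any fixed base greater than $1$ (e.g. natural). *)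

theory Defs
  imports "HOL-Probability.Probability"
begin

definition prob_mass :: "'a measure \<Rightarrow> ('a \<Rightarrow> int) \<Rightarrow> int \<Rightarrow> real" where
  "prob_mass M X n = \<P>(\<omega> in M. X \<omega> = n)"

definition int_random_variable :: "'a measure \<Rightarrow> ('a \<Rightarrow> int) \<Rightarrow> bool" where
  "int_random_variable M X \<longleftrightarrow> prob_space M \<and> X \<in> measurable M (count_space UNIV)"

definition log_concave_rv :: "'a measure \<Rightarrow> ('a \<Rightarrow> int) \<Rightarrow> bool" where
  "log_concave_rv M X \<longleftrightarrow>
     int_random_variable M X \<and>
     (\<forall>n. (prob_mass M X n)\<^sup>2 \<ge> prob_mass M X (n - 1) * prob_mass M X (n + 1)) \<and>
     (\<forall>a b n. prob_mass M X a > 0 \<and> prob_mass M X b > 0 \<and> a \<le> n \<and> n \<le> b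
        \<longrightarrow> prob_mass M X n > 0)"

definition geometric_rv :: "real \<Rightarrow> 'a measure \<Rightarrow> ('a \<Rightarrow> int) \<Rightarrow> bool" where
  "geometric_rv p M X \<longleftrightarrow>
     int_random_variable M X \<and> (\<forall>n::nat. prob_mass M X (int n) = p * (1 - p) ^ n)"

text \<open>Renyi entropy of order \<open>\<alpha> > 0\<close>, with logarithms to base \<open>b > 1\<close>.
  All summands (up to the global sign when \<open>\<alpha> = 1\<close>) are nonnegative, so a series that is not
  summable has an infinite sum. This can only happen for \<open>\<alpha> \<le> 1\<close>, and then the
  entropy is \<open>\<infinity>\<close>; for \<open>\<alpha> > 1\<close> the series always converges.\<close>

definition renyi_entropy :: "real \<Rightarrow> real \<Rightarrow> 'a measure \<Rightarrow> ('a \<Rightarrow> int) \<Rightarrow> ereal" where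
  "renyi_entropy b \<alpha> M X =
     (let P = prob_mass M X; S = {n. P n > 0} in
      if \<alpha> = 1 then
        (if (\<lambda>n. P n * log b (P n)) summable_on S
         then ereal (- (\<Sum>\<^sub>\<infinity>n\<in>S. P n * log b (P n))) else \<infinity>)
      else
        (if (\<lambda>n. P n powr \<alpha>) summable_on S
         then ereal (1 / (1 - \<alpha>) * log b (\<Sum>\<^sub>\<infinity>n\<in>S. P n powr \<alpha>)) else \<infinity>))"

definition renyi_entropy_infinity :: "real \<Rightarrow> 'a measure \<Rightarrow> ('a \<Rightarrow> int) \<Rightarrow> ereal" where
  "renyi_entropy_infinity b M X = ereal (- log b (SUP n. prob_mass M X n))"

text \<open>The number \<open>\<alpha>\<^bsup>1/(\<alpha>-1)\<^esup>\<close>, read as its limit \<open>e\<close> at \<open>\<alpha> = 1\<close>.\<close>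

definition gap_base :: "real \<Rightarrow> real" where
  "gap_base \<alpha> = (if \<alpha> = 1 then exp 1 else \<alpha> powr (1 / (\<alpha> - 1)))"

end

theory Submission
  imports Defs "HOL-Real_Asymp.Real_Asymp"
begin

text \<open>
  Let \<open>P\<close> be the mass function of \<open>X\<close> and \<open>m\<close> a mode. For \<open>\<alpha> \<noteq> 1\<close>, with
  \<open>q n = P n / P m\<close>, the gap between the two entropies is
  \<open>log (\<Sum> (q n)\<^sup>\<alpha> / \<Sum> q n) / (1 - \<alpha>)\<close>. Comparing it with \<open>log (gap_base \<alpha>)\<close> means
  finding the sign of \<open>T = \<Sum> gap_fun \<alpha> (q n)\<close>, where \<open>gap_fun \<alpha> t = (\<alpha> t\<^sup>\<alpha> - t) / (1 - \<alpha>)\<close>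
  is concave in \<open>t\<close>. For \<open>\<alpha> = 1\<close> the function is the limit \<open>- t - t ln t\<close> and the Shannon entropy
  behaves in the same way. The exact relation, for all \<open>\<alpha>\<close>, is \<open>renyi_gap_eq\<close>: the gap lies
  below, at or above \<open>log (gap_base \<alpha>)\<close> according to whether \<open>T\<close> is negative, zero or positive.

  To show \<open>T < 0\<close>, split the integers at the mode and share its term \<open>gap_fun \<alpha> 1 = - 1\<close> equally
  between the two sides. It then suffices that a log-concave sequence \<open>q 0 = 1, q 1, q 2, \<dots>\<close> with
  values in \<open>[0, 1]\<close> satisfies \<open>\<Sum> gap_fun \<alpha> (q n) < - 1 / 2\<close> (\<open>one_sided_gap\<close>). Compare \<open>q\<close>
  with the geometric sequence \<open>x\<^sup>n\<close> of the same sum. By log-concavity \<open>q\<close> crosses it once, from above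
  to below (\<open>log_concave_crosses_geometric_once\<close>), so \<open>q\<close> is the more concentrated of the two, and concavity
  gives \<open>\<Sum> gap_fun \<alpha> (q n) \<le> \<Sum> gap_fun \<alpha> (x\<^sup>n)\<close> (\<open>single_crossing_sum_le\<close>). For the geometric
  sequence the sum is explicit, and \<open>geo_gap_less\<close> bounds it by \<open>- 1 / 2\<close>; this amounts to the
  strict monotonicity of \<open>u coth u\<close> for \<open>u > 0\<close>.

  The geometric law itself has its mode at \<open>0\<close>, and \<open>T\<close> is the explicit one-sided sum. The
  relation involves \<open>T\<close> only through the product \<open>P m * T\<close>, and for the geometric law this product
  tends to \<open>0\<close> as \<open>p\<close> tends to \<open>0\<close>, so the gap tends to \<open>log (gap_base \<alpha>)\<close>.
\<close>

section \<open>The concave function behind the gap\<close>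

text \<open>
  Weighted AM-GM. Concavity of the power function on the open half-line would not cover \<open>t = 0\<close>,
  which is needed because the mass function may vanish.
\<close>
lemma powr_le_tangent:
  fixes s t a :: real
  assumes "0 < s" "0 \<le> t" "0 < a" "a \<le> 1"
  shows "t powr a \<le> s powr a + a * s powr (a - 1) * (t - s)"
proof (cases "t = 0")
  case True
  have "s powr a = s powr (a - 1) * s" using assms by (simp add: powr_diff)
  then show ?thesis using assms True by (simp add: mult_left_le_one_le)
next
  case False
  have "t powr a * s powr (1 - a) \<le> a * t + (1 - a) * s"
    using Youngs_inequality_0[of a "1 - a" t s] assms False by simp
  then have "t powr a * s powr (1 - a) * s powr (a - 1) \<le> (a * t + (1 - a) * s) * s powr (a - 1)"
    by (rule mult_right_mono) simp
  moreover have "t powr a * s powr (1 - a) * s powr (a - 1) = t powr a"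
    using assms by (simp add: mult.assoc flip: powr_add[of s "1 - a"])
  moreover have "s powr a = s powr (a - 1) * s" using assms by (simp add: powr_diff)
  ultimately have "t powr a \<le> (a * t + (1 - a) * s) * s powr (a - 1)" by simp
  also have "\<dots> = s powr (a - 1) * s + a * s powr (a - 1) * (t - s)" by (simp add: algebra_simps)
  finally show ?thesis using \<open>s powr a = _\<close> by simp
qed

text \<open>
  The previous inequality for the inverse power \<open>1/a\<close>, at the points \<open>s\<^sup>a\<close> and \<open>t\<^sup>a\<close>.
\<close>
lemma powr_ge_tangent:
  fixes s t a :: real
  assumes "0 < s" "0 \<le> t" "1 \<le> a"
  shows "t powr a \<ge> s powr a + a * s powr (a - 1) * (t - s)"
proof -
  have "a * (1 / a - 1) = 1 - a" using assms by (simp add: field_simps)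
  then have *: "t \<le> s + (1 / a) * (s powr (1 - a)) * (t powr a - s powr a)"
    using powr_le_tangent[of "s powr a" "t powr a" "1 / a"] assms
    by (simp add: powr_powr)
  have "a * s powr (a - 1) * (t - s) \<le>
      a * s powr (a - 1) * ((1 / a) * s powr (1 - a) * (t powr a - s powr a))"
    using * assms by (intro mult_left_mono) auto
  also have "\<dots> = (s powr (a - 1) * s powr (1 - a)) * (t powr a - s powr a)"
    using assms by simp
  also have "\<dots> = t powr a - s powr a"
    using assms by (simp flip: powr_add)
  finally show ?thesis by simp
qed

text \<open>
  For \<open>\<alpha> \<noteq> 1\<close>, summing this over \<open>P n / P m\<close> compares \<open>\<alpha> \<Sum> (P n / P m)\<^sup>\<alpha>\<close> with
  \<open>\<Sum> P n / P m\<close>, and this comparison is what the bound on the entropy gap says. Dividing by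
  \<open>1 - \<alpha>\<close> makes the function concave on both sides of \<open>\<alpha> = 1\<close>, gives it the value \<open>-1\<close>
  at \<open>t = 1\<close>, and gives it the limit \<open>- t - t ln t\<close> as \<open>\<alpha>\<close> tends to \<open>1\<close>.
\<close>
definition gap_fun :: "real \<Rightarrow> real \<Rightarrow> real" where
  "gap_fun \<alpha> t = (if \<alpha> = 1 then - t - t * ln t else (\<alpha> * t powr \<alpha> - t) / (1 - \<alpha>))"

text \<open>The derivative of \<open>gap_fun \<alpha>\<close>.\<close>
definition gap_slope :: "real \<Rightarrow> real \<Rightarrow> real" where
  "gap_slope \<alpha> s = (if \<alpha> = 1 then - 2 - ln s else (\<alpha>\<^sup>2 * s powr (\<alpha> - 1) - 1) / (1 - \<alpha>))"

lemma gap_fun_0 [simp]: "gap_fun \<alpha> 0 = 0"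
  and gap_fun_1 [simp]: "gap_fun \<alpha> 1 = -1"
  by (auto simp: gap_fun_def divide_simps)

lemma gap_fun_le_tangent:
  assumes "\<alpha> > 0" "0 < s" "0 \<le> t"
  shows "gap_fun \<alpha> t \<le> gap_fun \<alpha> s + gap_slope \<alpha> s * (t - s)"
proof (cases \<alpha> "1::real" rule: linorder_cases)
  case less
  have "\<alpha> * t powr \<alpha> \<le> \<alpha> * (s powr \<alpha> + \<alpha> * s powr (\<alpha> - 1) * (t - s))"
    using powr_le_tangent[of s t \<alpha>] assms less by (intro mult_left_mono) auto
  then have "(\<alpha> * t powr \<alpha> - t) / (1 - \<alpha>)
      \<le> ((\<alpha> * s powr \<alpha> - s) + (\<alpha>\<^sup>2 * s powr (\<alpha> - 1) - 1) * (t - s)) / (1 - \<alpha>)"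
    using less by (intro divide_right_mono) (auto simp: algebra_simps power2_eq_square)
  then show ?thesis using less by (simp add: gap_fun_def gap_slope_def add_divide_distrib)
next
  case greater
  have "\<alpha> * t powr \<alpha> \<ge> \<alpha> * (s powr \<alpha> + \<alpha> * s powr (\<alpha> - 1) * (t - s))"
    using powr_ge_tangent[of s t \<alpha>] assms greater by (intro mult_left_mono) auto
  then have "(\<alpha> * t powr \<alpha> - t) / (1 - \<alpha>)
      \<le> ((\<alpha> * s powr \<alpha> - s) + (\<alpha>\<^sup>2 * s powr (\<alpha> - 1) - 1) * (t - s)) / (1 - \<alpha>)"
    using greater by (intro divide_right_mono_neg) (auto simp: algebra_simps power2_eq_square)
  then show ?thesis using greater by (simp add: gap_fun_def gap_slope_def add_divide_distrib)
next
  case equal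
  show ?thesis
  proof (cases "t = 0")
    case True
    then show ?thesis using assms equal by (simp add: gap_fun_def gap_slope_def algebra_simps)
  next
    case False
    have "ln (s / t) \<le> s / t - 1" using assms False by (intro ln_le_minus_one) auto
    then have "t * (ln s - ln t) \<le> t * (s / t - 1)"
      using assms False by (intro mult_left_mono) (auto simp: ln_div)
    then have "t * ln s - t * ln t \<le> s - t" using False by (simp add: algebra_simps)
    then show ?thesis using equal by (simp add: gap_fun_def gap_slope_def algebra_simps)
  qed
qed

lemma gap_slope_antimono:
  assumes "\<alpha> > 0" "0 < s" "s \<le> t"
  shows "gap_slope \<alpha> t \<le> gap_slope \<alpha> s"
proof (cases \<alpha> "1::real" rule: linorder_cases)
  case less
  then have "t powr (\<alpha> - 1) \<le> s powr (\<alpha> - 1)"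
    using assms by (intro powr_mono2') auto
  then show ?thesis using less by (simp add: gap_slope_def divide_right_mono mult_left_mono)
next
  case greater
  then have "s powr (\<alpha> - 1) \<le> t powr (\<alpha> - 1)"
    using assms by (intro powr_mono2) auto
  then show ?thesis using greater by (simp add: gap_slope_def divide_right_mono_neg mult_left_mono)
next
  case equal
  then show ?thesis using assms by (simp add: gap_slope_def)
qed

text \<open>
  This lower bound turns convergence of \<open>\<Sum> q n\<close> into absolute convergence of
  \<open>\<Sum> gap_fun \<alpha> (q n)\<close> as soon as the partial sums of the latter are bounded above.
\<close>
lemma gap_fun_ge:
  assumes "\<alpha> > 0" "0 \<le> t" "t \<le> 1"
  shows "- t \<le> gap_fun \<alpha> t"
proof (cases \<alpha> "1::real" rule: linorder_cases)
  case less
  have "t powr \<alpha> \<ge> t" using assms less powr_mono'[of \<alpha> 1 t] by (cases "t = 0") auto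
  then have "\<alpha> * t \<le> \<alpha> * t powr \<alpha>" using assms by simp
  then show ?thesis using less by (simp add: gap_fun_def field_simps)
next
  case greater
  have "t powr \<alpha> \<le> t" using assms greater powr_mono'[of 1 \<alpha> t] by (cases "t = 0") auto
  then have "\<alpha> * t powr \<alpha> \<le> \<alpha> * t" using assms by simp
  then show ?thesis using greater by (simp add: gap_fun_def field_simps)
next
  case equal
  have "t * ln t \<le> 0" using assms by (cases "t = 0") (auto simp: mult_le_0_iff)
  then show ?thesis using equal by (simp add: gap_fun_def)
qed

section \<open>Geometric sequences\<close>

text \<open>The closed form of \<open>\<Sum> gap_fun \<alpha> (x\<^sup>n)\<close> over \<open>n \<ge> 0\<close>.\<close>
definition geo_gap :: "real \<Rightarrow> real \<Rightarrow> real" where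
  "geo_gap \<alpha> x =
     (if \<alpha> = 1 then - 1 / (1 - x) - x * ln x / (1 - x)\<^sup>2
      else (\<alpha> / (1 - x powr \<alpha>) - 1 / (1 - x)) / (1 - \<alpha>))"

lemma gap_fun_geometric_sums:
  assumes "\<alpha> > 0" "0 < x" "x < 1"
  shows "(\<lambda>n. gap_fun \<alpha> (x ^ n)) sums geo_gap \<alpha> x"
proof -
  have geo: "(\<lambda>n. x ^ n) sums (1 / (1 - x))" using assms by (intro geometric_sums) auto
  show ?thesis
  proof (cases "\<alpha> = 1")
    case True
    have "(\<lambda>n. of_nat (Suc n) * x ^ n) sums (1 / (1 - x)\<^sup>2)"
      using assms by (intro geometric_deriv_sums) auto
    from sums_diff[OF this geo]
    have "(\<lambda>n. n * x ^ n) sums (1 / (1 - x)\<^sup>2 - 1 / (1 - x))" by (simp add: algebra_simps)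
    also have "1 / (1 - x)\<^sup>2 - 1 / (1 - x) = x / (1 - x)\<^sup>2"
      using assms by (simp add: divide_simps power2_eq_square)
    finally have "(\<lambda>n. n * x ^ n) sums (x / (1 - x)\<^sup>2)" .
    from sums_diff[OF sums_minus[OF geo] sums_mult2[OF this, of "ln x"]]
    have "(\<lambda>n. - (x ^ n) - n * x ^ n * ln x) sums (- 1 / (1 - x) - x * ln x / (1 - x)\<^sup>2)"
      by simp
    moreover have "gap_fun \<alpha> (x ^ n) = - (x ^ n) - n * x ^ n * ln x" for n
      using assms True by (simp add: gap_fun_def ln_realpow)
    ultimately show ?thesis using True by (simp add: geo_gap_def)
  next
    case False
    have "(\<lambda>n. (x powr \<alpha>) ^ n) sums (1 / (1 - x powr \<alpha>))"
      using assms powr_less_mono2[of \<alpha> x 1] by (intro geometric_sums) auto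
    moreover have "(x powr \<alpha>) ^ n = (x ^ n) powr \<alpha>" for n
      using assms by (simp add: powr_powr mult.commute flip: powr_realpow)
    ultimately have "(\<lambda>n. (x ^ n) powr \<alpha>) sums (1 / (1 - x powr \<alpha>))" by simp
    from sums_divide[OF sums_diff[OF sums_mult[OF this, of \<alpha>] geo], of "1 - \<alpha>"]
    show ?thesis using False by (simp add: gap_fun_def geo_gap_def)
  qed
qed

text \<open>
  With \<open>x = exp (- w)\<close> this is \<open>w < sinh w\<close> for \<open>w > 0\<close>. The proof differentiates
  \<open>x - 1/x - 2 ln x\<close>, whose derivative is a square and which vanishes at \<open>1\<close>.
\<close>
lemma ln_bound_symmetric:
  fixes x :: real
  assumes "0 < x" "x < 1"
  shows "0 < 1 - x\<^sup>2 + 2 * x * ln x"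
proof -
  have "x - 1 / x - 2 * ln x < 1 - 1 / 1 - 2 * ln 1"
  proof (rule DERIV_pos_imp_increasing_open[OF assms(2)])
    fix y :: real assume y: "x < y" "y < 1"
    have "((\<lambda>x. x - 1 / x - 2 * ln x) has_real_derivative (1 - 1 / y)\<^sup>2) (at y)"
      using assms y by (auto intro!: derivative_eq_intros simp: field_simps power2_eq_square)
    moreover have "(1 - 1 / y)\<^sup>2 > 0" using assms y by simp
    ultimately show "\<exists>d. ((\<lambda>x. x - 1 / x - 2 * ln x) has_real_derivative d) (at y) \<and> 0 < d"
      by blast
  qed (use assms in \<open>intro continuous_intros; simp\<close>)
  then have "x * (x - 1 / x - 2 * ln x) < 0"
    using assms by (simp add: mult_less_0_iff)
  moreover have "x * (x - 1 / x - 2 * ln x) = x\<^sup>2 - 1 - 2 * x * ln x"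
    using assms by (simp add: algebra_simps power2_eq_square)
  ultimately show ?thesis by linarith
qed

text \<open>
  With \<open>x = exp (- 2 w)\<close> the compared function is \<open>y coth (w y) / 2\<close>, so this is the monotonicity
  of \<open>u coth u\<close>. The subtracted half accounts for the term at the mode, which the two halves of a
  distribution share; the weaker monotonicity of \<open>y / (1 - x\<^sup>y)\<close> would not suffice for adding them.
\<close>
lemma coth_type_strict_mono:
  fixes x a c :: real
  assumes x: "0 < x" "x < 1" and ac: "0 < a" "a < c"
  shows "a / (1 - x powr a) - a / 2 < c / (1 - x powr c) - c / 2"
proof (rule DERIV_pos_imp_increasing_open[OF ac(2)])
  have lt1: "x powr y < 1" if "y > 0" for y using powr_less_mono2[of y x 1] x that by simp
  fix y assume y: "a < y" "y < c"
  \<comment> \<open>in terms of \<open>E\<close> the numerator of the derivative is the quantity of \<open>ln_bound_symmetric\<close>\<close>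
  define E where "E = x powr y"
  have E: "0 < E" "E < 1" using x y ac lt1[of y] by (auto simp: E_def)
  have lnE: "ln E = y * ln x" using x by (simp add: E_def ln_powr)
  have "((\<lambda>y. y / (1 - x powr y) - y / 2) has_real_derivative
      ((1 - E\<^sup>2 + 2 * E * ln E) / (2 * (1 - E)\<^sup>2))) (at y)"
    unfolding lnE
    using E x by (auto intro!: derivative_eq_intros simp: E_def[symmetric])
       (simp add: divide_simps power2_eq_square, simp add: algebra_simps)
  moreover have "(1 - E\<^sup>2 + 2 * E * ln E) / (2 * (1 - E)\<^sup>2) > 0"
    using ln_bound_symmetric[OF E] E by simp
  ultimately show "\<exists>d. ((\<lambda>y. y / (1 - x powr y) - y / 2) has_real_derivative d) (at y) \<and> 0 < d"
    by blast
next
  have lt1: "x powr y < 1" if "y > 0" for y using powr_less_mono2[of y x 1] x that by simp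
  show "continuous_on {a..c} (\<lambda>y. y / (1 - x powr y) - y / 2)"
    using x ac lt1 by (intro continuous_intros) force+
qed

text \<open>
  For \<open>\<alpha> \<noteq> 1\<close> this is \<open>coth_type_strict_mono\<close> between \<open>\<alpha>\<close> and \<open>1\<close>; for \<open>\<alpha> = 1\<close> it is
  the infinitesimal form \<open>ln_bound_symmetric\<close>. The bound is half of \<open>gap_fun \<alpha> 1 = - 1\<close>.
\<close>
lemma geo_gap_less:
  assumes "\<alpha> > 0" "0 < x" "x < 1"
  shows "geo_gap \<alpha> x < - 1 / 2"
proof (cases \<alpha> "1::real" rule: linorder_cases)
  case less
  define A B where "A = \<alpha> / (1 - x powr \<alpha>)" and "B = 1 / (1 - x)"
  have "A - \<alpha> / 2 < B - 1 / 2"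
    using coth_type_strict_mono[of x \<alpha> 1] assms less by (simp add: A_def B_def)
  then have "(A - B) / (1 - \<alpha>) < - 1 / 2" using less by (simp add: pos_divide_less_eq) (simp add: field_simps)
  then show ?thesis using less by (simp add: geo_gap_def A_def B_def)
next
  case greater
  define A B where "A = \<alpha> / (1 - x powr \<alpha>)" and "B = 1 / (1 - x)"
  have "B - 1 / 2 < A - \<alpha> / 2"
    using coth_type_strict_mono[of x 1 \<alpha>] assms greater by (simp add: A_def B_def)
  then have "(A - B) / (1 - \<alpha>) < - 1 / 2" using greater by (simp add: neg_divide_less_eq) (simp add: field_simps)
  then show ?thesis using greater by (simp add: geo_gap_def A_def B_def)
next
  case equal
  have "geo_gap \<alpha> x + 1 / 2 = - (1 - x\<^sup>2 + 2 * x * ln x) / (2 * (1 - x)\<^sup>2)"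
    using assms equal by (simp add: geo_gap_def divide_simps power2_eq_square) (simp add: algebra_simps)
  also have "\<dots> < 0" using ln_bound_symmetric[of x] assms by (simp add: divide_neg_pos)
  finally show ?thesis by simp
qed

text \<open>
  The factor \<open>p\<close> is the mass of the geometric distribution at its mode, so this says that the
  correction to \<open>log b (gap_base \<alpha>)\<close> vanishes for the geometric law as \<open>p\<close> tends to \<open>0\<close>.
\<close>
lemma geo_gap_tendsto:
  assumes "\<alpha> > 0"
  shows "((\<lambda>p. p * geo_gap \<alpha> (1 - p)) \<longlongrightarrow> 0) (at_right 0)"
proof (cases "\<alpha> = 1")
  case True
  have "((\<lambda>p::real. p * (- 1 / p - (1 - p) * ln (1 - p) / p\<^sup>2)) \<longlongrightarrow> 0) (at_right 0)"
    by real_asymp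
  then show ?thesis using True by (simp add: geo_gap_def)
next
  case False
  have "((\<lambda>p::real. \<alpha> * p / (1 - (1 - p) powr \<alpha>)) \<longlongrightarrow> 1) (at_right 0)"
    using assms by real_asymp
  then have "((\<lambda>p::real. (\<alpha> * p / (1 - (1 - p) powr \<alpha>) - 1) / (1 - \<alpha>))
      \<longlongrightarrow> (1 - 1) / (1 - \<alpha>)) (at_right 0)"
    using False by (intro tendsto_intros) auto
  moreover have "\<forall>\<^sub>F p in at_right 0. (\<alpha> * p / (1 - (1 - p) powr \<alpha>) - 1) / (1 - \<alpha>)
      = p * geo_gap \<alpha> (1 - p)"
    using eventually_at_right_less[of "0::real"]
    by eventually_elim (use False in \<open>simp add: geo_gap_def right_diff_distrib mult.commute\<close>)
  ultimately show ?thesis by (simp add: tendsto_cong)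
qed

section \<open>Comparison of a log-concave sequence with a geometric one\<close>

text \<open>
  The quotient \<open>q n / x\<^sup>n\<close> is again log-concave and starts at \<open>1\<close>. Once it has dropped below
  \<open>1\<close> it has had a decreasing step, and by log-concavity it goes on decreasing; the support condition
  keeps it at \<open>0\<close> once it is there. So \<open>q\<close> crosses the geometric sequence only once.
\<close>
lemma log_concave_crosses_geometric_once:
  fixes q :: "nat \<Rightarrow> real" and x :: real
  assumes q0: "q 0 = 1" and nonneg: "\<And>n. 0 \<le> q n" and x: "0 < x"
    and logconc: "\<And>n. q n * q (n + 2) \<le> (q (n + 1))\<^sup>2"
    and support: "\<And>n. q n = 0 \<Longrightarrow> q (n + 1) = 0"
    and ex: "\<exists>n. q n < x ^ n"
  shows "\<exists>N. (\<forall>n\<le>N. x ^ n \<le> q n) \<and> (\<forall>n>N. q n \<le> x ^ n)"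
proof -
  define \<rho> where "\<rho> n = q n / x ^ n" for n
  have lt1: "\<rho> n < 1 \<longleftrightarrow> q n < x ^ n" and le1: "\<rho> n \<le> 1 \<longleftrightarrow> q n \<le> x ^ n" for n
    using x by (simp_all add: \<rho>_def divide_less_eq divide_le_eq)
  have \<rho>_nonneg: "0 \<le> \<rho> n" for n using nonneg x by (simp add: \<rho>_def)
  have \<rho>_logconc: "\<rho> n * \<rho> (n + 2) \<le> \<rho> (n + 1) * \<rho> (n + 1)" for n
  proof -
    have "\<rho> n * \<rho> (n + 2) = q n * q (n + 2) / (x ^ (n + 1) * x ^ (n + 1))"
      by (simp add: \<rho>_def mult_ac)
    also have "\<dots> \<le> (q (n + 1))\<^sup>2 / (x ^ (n + 1) * x ^ (n + 1))"
      using logconc x by (intro divide_right_mono) auto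
    also have "\<dots> = \<rho> (n + 1) * \<rho> (n + 1)" by (simp add: \<rho>_def power2_eq_square)
    finally show ?thesis .
  qed
  define k where "k = (LEAST n. q n < x ^ n)"
  have k: "q k < x ^ k" unfolding k_def by (rule LeastI_ex[OF ex])
  have below: "x ^ n \<le> q n" if "n < k" for n using not_less_Least[OF that[unfolded k_def]] by simp
  have "k \<noteq> 0" using k q0 by (intro notI) simp
  then obtain N where N: "k = Suc N" by (cases k) auto
  have "\<rho> (N + 1 + n) < 1 \<and> \<rho> (N + 1 + n) \<le> \<rho> (N + n)" for n
  proof (induction n)
    case 0
    then show ?case using k below[of N] lt1[of N] lt1[of k] N by auto
  next
    case (Suc n)
    show ?case
    proof (cases "\<rho> (N + 1 + n) = 0")
      case True
      then have "\<rho> (N + 1 + Suc n) = 0" using support[of "N + 1 + n"] x by (simp add: \<rho>_def)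
      then show ?thesis using True by simp
    next
      case False
      then have pos: "0 < \<rho> (N + 1 + n)" using \<rho>_nonneg[of "N + 1 + n"] by simp
      have "\<rho> (N + 1 + n) * \<rho> (N + 1 + Suc n) \<le> \<rho> (N + n) * \<rho> (N + 1 + Suc n)"
        using Suc \<rho>_nonneg by (intro mult_right_mono) auto
      also have "\<dots> \<le> \<rho> (N + 1 + n) * \<rho> (N + 1 + n)" using \<rho>_logconc[of "N + n"] by simp
      finally have "\<rho> (N + 1 + Suc n) \<le> \<rho> (N + 1 + n)" using pos by simp
      then show ?thesis using Suc by simp
    qed
  qed
  then have "q n \<le> x ^ n" if "n > N" for n
    using le1[of n] le_add_diff_inverse[of "N + 1" n] that by (metis Suc_eq_plus1 Suc_leI less_imp_le)
  then show ?thesis using below N by (intro exI[of _ N]) auto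
qed

text \<open>
  A majorization argument: \<open>q\<close> has the same total as \<open>r\<close> but is less spread out, so a sum of concave
  functions is smaller for \<open>q\<close>. Bound \<open>\<phi> (q n)\<close> by the tangent of \<open>\<phi>\<close> at \<open>r n\<close>. Since
  \<open>q n - r n\<close> changes sign at \<open>N\<close> and the slopes at \<open>r n\<close> increase with \<open>n\<close>, replacing each
  slope by the one at \<open>r N\<close> only increases the bound, and then the linear terms cancel in the sum. The
  bound is termwise, so it also yields convergence.
\<close>
lemma single_crossing_sum_le:
  fixes q r :: "nat \<Rightarrow> real" and \<phi> d :: "real \<Rightarrow> real"
  assumes q: "q sums S" and r: "r sums S"
    and early: "\<And>n. n \<le> N \<Longrightarrow> r n \<le> q n" and late: "\<And>n. n > N \<Longrightarrow> q n \<le> r n"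
    and nonneg: "\<And>n. 0 \<le> q n" and pos: "\<And>n. 0 < r n" and decr: "decseq r"
    and tangent: "\<And>s t. 0 < s \<Longrightarrow> 0 \<le> t \<Longrightarrow> \<phi> t \<le> \<phi> s + d s * (t - s)"
    and antimono: "\<And>s t. 0 < s \<Longrightarrow> s \<le> t \<Longrightarrow> d t \<le> d s"
    and lower: "\<And>n. - q n \<le> \<phi> (q n)"
    and sums_r: "(\<lambda>n. \<phi> (r n)) sums R"
  shows "\<exists>T\<le>R. (\<lambda>n. \<phi> (q n)) sums T"
proof -
  define u where "u n = \<phi> (r n) + d (r N) * (q n - r n)" for n
  have u_sums: "u sums R"
    using sums_add[OF sums_r sums_mult[OF sums_diff[OF q r], of "d (r N)"]] by (simp add: u_def[abs_def])
  have le_u: "\<phi> (q n) \<le> u n" for n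
  proof -
    have "d (r n) * (q n - r n) \<le> d (r N) * (q n - r n)"
    proof (cases "n \<le> N")
      case True
      then show ?thesis using early[OF True] antimono[OF pos, of N "r n"] decseqD[OF decr True]
        by (intro mult_right_mono) auto
    next
      case False
      then show ?thesis using late[of n] antimono[OF pos, of n "r N"] decseqD[OF decr, of N n]
        by (intro mult_right_mono_neg) auto
    qed
    then show ?thesis using tangent[OF pos nonneg, of n n] by (simp add: u_def)
  qed
  have "summable (\<lambda>n. \<phi> (q n) + q n)"
  proof (rule summable_comparison_test')
    show "summable (\<lambda>n. u n + q n)"
      using u_sums q by (intro summable_add) (auto simp: sums_iff)
    show "norm (\<phi> (q n) + q n) \<le> u n + q n" for n
      using lower[of n] le_u[of n] by simp
  qed
  from summable_diff[OF this, of q] have "summable (\<lambda>n. \<phi> (q n))"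
    using q by (auto simp: sums_iff)
  then have "(\<lambda>n. \<phi> (q n)) sums (\<Sum>n. \<phi> (q n))" by (rule summable_sums)
  with sums_le[OF le_u this u_sums] show ?thesis by blast
qed

lemma sums_gap_fun_imp_has_sum:
  assumes \<alpha>: "\<alpha> > 0" and q01: "\<And>n. 0 \<le> q n" "\<And>n. q n \<le> 1" and "summable q"
    and T: "(\<lambda>n. gap_fun \<alpha> (q n)) sums T"
  shows "((\<lambda>n. gap_fun \<alpha> (q n)) has_sum T) UNIV"
proof -
  have "(\<lambda>n. gap_fun \<alpha> (q n) + q n) sums (T + (\<Sum>n. q n))"
    using T \<open>summable q\<close> by (intro sums_add summable_sums)
  moreover have "0 \<le> gap_fun \<alpha> (q n) + q n" for n
    using gap_fun_ge[OF \<alpha> q01, of n] by simp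
  ultimately have "((\<lambda>n. gap_fun \<alpha> (q n) + q n) has_sum (T + (\<Sum>n. q n))) UNIV"
    by (rule sums_nonneg_imp_has_sum)
  moreover have "(q has_sum (\<Sum>n. q n)) UNIV"
    using \<open>summable q\<close> q01 by (intro sums_nonneg_imp_has_sum summable_sums)
  ultimately have "((\<lambda>n. (gap_fun \<alpha> (q n) + q n) + - q n) has_sum
      ((T + (\<Sum>n. q n)) + - (\<Sum>n. q n))) UNIV"
    by (rule has_sum_add[OF _ has_sum_uminusI])
  then show ?thesis by simp
qed

text \<open>
  The comparison sequence is the geometric one with the same sum \<open>S\<close>. The case \<open>S = 1\<close> is separate:
  its ratio would be \<open>0\<close>, where tangents are not available.
\<close>
lemma one_sided_gap:
  fixes q :: "nat \<Rightarrow> real"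
  assumes \<alpha>: "\<alpha> > 0" and q0: "q 0 = 1" and nonneg: "\<And>n. 0 \<le> q n" and le1: "\<And>n. q n \<le> 1"
    and logconc: "\<And>n. q n * q (n + 2) \<le> (q (n + 1))\<^sup>2"
    and support: "\<And>n. q n = 0 \<Longrightarrow> q (n + 1) = 0"
    and summable: "summable q"
  shows "\<exists>T < - 1 / 2. (\<lambda>n. gap_fun \<alpha> (q n)) sums T"
proof -
  define S where "S = (\<Sum>n. q n)"
  have q_sums: "q sums S" using summable by (simp add: S_def summable_sums)
  have "S \<ge> 1"
    using sum_le_suminf[OF summable, of "{0}"] nonneg q0 by (simp add: S_def)
  show ?thesis
  proof (cases "S = 1")
    case True
    have "q n = 0" if "n > 0" for n
    proof -
      have "sum q {0, n} \<le> S" unfolding S_def using nonneg by (intro sum_le_suminf summable) auto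
      then show ?thesis using True nonneg[of n] q0 that by simp
    qed
    then have "(\<lambda>n. gap_fun \<alpha> (q n)) = (\<lambda>n. if n = 0 then -1 else 0)" using q0 by auto
    then show ?thesis using sums_single[of 0 "\<lambda>_. -1::real"] by (intro exI[of _ "-1"]) simp
  next
    case False
    define x where "x = 1 - 1 / S"
    have x: "0 < x" "x < 1" using False \<open>S \<ge> 1\<close> by (auto simp: x_def)
    have r: "(\<lambda>n. x ^ n) sums S"
      using geometric_sums[of x] x \<open>S \<ge> 1\<close> by (simp add: x_def)
    \<comment> \<open>if \<open>q\<close> never drops below the geometric sequence, equality of the sums makes them equal\<close>
    have "\<exists>N. (\<forall>n\<le>N. x ^ n \<le> q n) \<and> (\<forall>n>N. q n \<le> x ^ n)"
    proof (cases "\<exists>n. q n < x ^ n")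
      case True
      then show ?thesis by (intro log_concave_crosses_geometric_once q0 nonneg x logconc support)
    next
      case False
      then have "\<forall>n. 0 \<le> q n - x ^ n" by (simp add: not_less)
      moreover have "(\<lambda>n. q n - x ^ n) sums 0" using sums_diff[OF q_sums r] by simp
      ultimately have "q n = x ^ n" for n
        using suminf_eq_zero_iff[of "\<lambda>n. q n - x ^ n"] by (simp add: sums_iff)
      then show ?thesis by simp
    qed
    then obtain N where N: "\<And>n. n \<le> N \<Longrightarrow> x ^ n \<le> q n" "\<And>n. n > N \<Longrightarrow> q n \<le> x ^ n" by blast
    then have "\<exists>T\<le>geo_gap \<alpha> x. (\<lambda>n. gap_fun \<alpha> (q n)) sums T"
      using x by (intro single_crossing_sum_le[OF q_sums r N nonneg _ _
          gap_fun_le_tangent[OF \<alpha>] gap_slope_antimono[OF \<alpha>] gap_fun_ge[OF \<alpha> nonneg le1]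
          gap_fun_geometric_sums[OF \<alpha> x]]) (auto intro!: decseq_SucI simp: mult_left_le_one_le)
    then show ?thesis using geo_gap_less[OF \<alpha> x] by (meson le_less_trans)
  qed
qed

section \<open>Mass functions on the integers\<close>

lemma has_sum_int_from_halves:
  fixes f :: "int \<Rightarrow> real"
  assumes "((\<lambda>k. f (m + int k)) has_sum s) UNIV" and "((\<lambda>k. f (m - int k)) has_sum t) UNIV"
  shows "(f has_sum (s + t - f m)) UNIV"
proof -
  have "bij_betw (\<lambda>k. m + int k) UNIV {m..}"
    by (rule bij_betwI[where g = "\<lambda>n. nat (n - m)"]) auto
  from has_sum_reindex_bij_betw[OF this, of f s] assms(1) have right: "(f has_sum s) {m..}" by simp
  have "bij_betw (\<lambda>k. m - int k) UNIV {..m}"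
    by (rule bij_betwI[where g = "\<lambda>n. nat (m - n)"]) auto
  from has_sum_reindex_bij_betw[OF this, of f t] assms(2) have left: "(f has_sum t) {..m}" by simp
  have "(f has_sum (t - f m)) ({..m} - {m})"
    using has_sum_Diff[OF left, of "{m}" "f m"] has_sum_finite[of "{m}" f] by simp
  also have "{..m} - {m} = {..<m}" by auto
  finally have "(f has_sum (s + (t - f m))) ({m..} \<union> {..<m})"
    using right by (intro has_sum_Un_disjoint[where A = "{m..}"]) auto
  also have "{m..} \<union> {..<m} = UNIV" by auto
  also have "s + (t - f m) = s + t - f m" by simp
  finally show ?thesis .
qed

text \<open>
  Both halves, each starting at the mode \<open>m\<close>, contribute less than \<open>- 1 / 2\<close>; the mode is counted
  twice and its term is \<open>- 1\<close>, so the total is less than \<open>- 1 / 2 - 1 / 2 + 1\<close>.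
\<close>
lemma two_sided_gap:
  fixes P :: "int \<Rightarrow> real"
  assumes \<alpha>: "\<alpha> > 0" and nonneg: "\<And>n. 0 \<le> P n" and sum: "P summable_on UNIV"
    and mode: "\<And>n. P n \<le> P m" "0 < P m"
    and logconc: "\<And>n. P (n - 1) * P (n + 1) \<le> (P n)\<^sup>2"
    and support: "\<And>a b n. 0 < P a \<Longrightarrow> 0 < P b \<Longrightarrow> a \<le> n \<Longrightarrow> n \<le> b \<Longrightarrow> 0 < P n"
  shows "\<exists>T<0. ((\<lambda>n. gap_fun \<alpha> (P n / P m)) has_sum T) UNIV"
proof -
  \<comment> \<open>the sign \<open>\<epsilon>\<close> selects the right or the left half\<close>
  have half: "\<exists>T < - 1 / 2. ((\<lambda>k. gap_fun \<alpha> (P (m + \<epsilon> * int k) / P m)) has_sum T) UNIV"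
    if \<epsilon>: "\<epsilon> = 1 \<or> \<epsilon> = - 1" for \<epsilon> :: int
  proof -
    define q where "q k = P (m + \<epsilon> * int k) / P m" for k
    have q01: "0 \<le> q k" "q k \<le> 1" for k using nonneg mode by (simp_all add: q_def)
    have inj: "inj (\<lambda>k. m + \<epsilon> * int k)" using \<epsilon> by (auto intro!: injI)
    have "P summable_on range (\<lambda>k. m + \<epsilon> * int k)"
      using sum by (rule summable_on_subset_banach) simp
    then have "summable (\<lambda>k. P (m + \<epsilon> * int k))"
      by (simp add: summable_on_reindex[OF inj] o_def summable_on_imp_summable)
    then have "summable q" unfolding q_def by (rule summable_divide)
    moreover have "q k * q (k + 2) \<le> (q (k + 1))\<^sup>2" for k
    proof -
      have "P (m + \<epsilon> * int k) * P (m + \<epsilon> * int (k + 2)) \<le> (P (m + \<epsilon> * int (k + 1)))\<^sup>2"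
        using logconc[of "m + \<epsilon> * int (k + 1)"] \<epsilon> by (auto simp: algebra_simps)
      then show ?thesis
        using mode by (simp add: q_def power_divide power2_eq_square divide_right_mono)
    qed
    moreover have "q (k + 1) = 0" if "q k = 0" for k
    proof (rule ccontr)
      assume "q (k + 1) \<noteq> 0"
      then have "0 < P (m + \<epsilon> * int (k + 1))"
        using nonneg[of "m + \<epsilon> * int (k + 1)"] by (auto simp: q_def)
      then have "0 < P (m + \<epsilon> * int k)"
        using support[of m _ "m + \<epsilon> * int k"] support[of _ m "m + \<epsilon> * int k"] mode \<epsilon> by auto
      then show False using that mode by (simp add: q_def)
    qed
    ultimately obtain T where T: "T < - 1 / 2" "(\<lambda>k. gap_fun \<alpha> (q k)) sums T"
      using one_sided_gap[OF \<alpha>, of q] q01 mode by (auto simp: q_def)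
    have "((\<lambda>k. gap_fun \<alpha> (q k)) has_sum T) UNIV"
      by (rule sums_gap_fun_imp_has_sum[OF \<alpha> q01 \<open>summable q\<close> T(2)])
    then show ?thesis using T by (auto simp: q_def)
  qed
  obtain s where s: "s < - 1 / 2" "((\<lambda>k. gap_fun \<alpha> (P (m + int k) / P m)) has_sum s) UNIV"
    using half[of 1] by auto
  obtain t where t: "t < - 1 / 2" "((\<lambda>k. gap_fun \<alpha> (P (m - int k) / P m)) has_sum t) UNIV"
    using half[of "-1"] by auto
  have "((\<lambda>n. gap_fun \<alpha> (P n / P m)) has_sum (s + t - gap_fun \<alpha> (P m / P m))) UNIV"
    using has_sum_int_from_halves[OF s(2) t(2)] .
  moreover have "gap_fun \<alpha> (P m / P m) = - 1" using mode by simp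
  ultimately show ?thesis using s(1) t(1) by (intro exI[of _ "s + t + 1"]) auto
qed

lemma summable_attains_max:
  fixes P :: "int \<Rightarrow> real"
  assumes "P summable_on UNIV" "\<And>n. 0 \<le> P n" "P a > 0"
  shows "\<exists>m. \<forall>n. P n \<le> P m"
proof -
  have fin: "finite {n. P a \<le> P n}"
  proof (rule ccontr)
    assume inf: "infinite {n. P a \<le> P n}"
    define s where "s = infsum P UNIV"
    obtain K where K: "real K * P a > s" using reals_Archimedean3[OF assms(3)] by auto
    obtain F where F: "finite F" "card F = K" "F \<subseteq> {n. P a \<le> P n}"
      using infinite_arbitrarily_large[OF inf, of K] by auto
    have "real K * P a \<le> sum P F" using F sum_bounded_below[of F "P a" P] by auto
    also have "\<dots> \<le> s" unfolding s_def using assms F by (intro finite_sum_le_infsum) auto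
    finally show False using K by simp
  qed
  have "Max (P ` {n. P a \<le> P n}) \<in> P ` {n. P a \<le> P n}"
    using fin by (intro Max_in) auto
  then obtain m where m: "P a \<le> P m" "P m = Max (P ` {n. P a \<le> P n})" by auto
  have "P n \<le> P m" for n
  proof (cases "P a \<le> P n")
    case True
    then show ?thesis unfolding m(2) using fin by (intro Max_ge) auto
  next
    case False
    then show ?thesis using m(1) by simp
  qed
  then show ?thesis by blast
qed

section \<open>Entropy gaps\<close>

lemma prob_mass_nonneg [simp]: "0 \<le> prob_mass M X n"
  by (simp add: prob_mass_def)

lemma prob_mass_has_sum_1:
  assumes "int_random_variable M X"
  shows "(prob_mass M X has_sum 1) UNIV"
proof -
  interpret prob_space M using assms by (simp add: int_random_variable_def)
  have X: "X \<in> measurable M (count_space UNIV)" using assms by (simp add: int_random_variable_def)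
  define A where "A i = {\<omega> \<in> space M. X \<omega> = int_decode i}" for i
  have sets: "range A \<subseteq> sets M" unfolding A_def using X by auto
  have disj: "disjoint_family A"
    by (auto simp: disjoint_family_on_def A_def inj_int_decode[THEN inj_eq])
  have UN: "(\<Union>i. A i) = space M"
    by (auto simp: A_def intro!: exI[of _ "int_encode _"])
  have "(\<lambda>i. prob (A i)) sums 1"
    using finite_measure_UNION[OF sets disj] by (simp add: UN prob_space)
  then have "((\<lambda>i. prob_mass M X (int_decode i)) has_sum 1) UNIV"
    by (intro sums_nonneg_imp_has_sum) (auto simp: A_def prob_mass_def)
  then show ?thesis by (simp add: has_sum_reindex_bij_betw[OF bij_int_decode, of "prob_mass M X"])
qed

text \<open>
  The amount, in natural units, by which an entropy gap exceeds \<open>ln (gap_base \<alpha>)\<close>, as a function of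
  \<open>\<tau> = P m * \<Sum> gap_fun \<alpha> (P n / P m)\<close>. It has the sign of \<open>\<tau>\<close>.
\<close>
definition gap_excess :: "real \<Rightarrow> real \<Rightarrow> real" where
  "gap_excess \<alpha> \<tau> = (if \<alpha> = 1 then \<tau> else ln (1 + (1 - \<alpha>) * \<tau>) / (1 - \<alpha>))"

text \<open>
  Solving the definition of \<open>gap_fun\<close> for \<open>P n powr \<alpha>\<close> (or \<open>P n * ln (P n)\<close>) expresses the
  entropy through \<open>T\<close> and the total mass \<open>1\<close>. In particular the entropy is finite whenever
  \<open>T\<close> exists. The second claim says that the argument of the logarithm in \<open>gap_excess\<close> is positive; up to
  a positive factor it is the sum of the \<open>P n powr \<alpha>\<close>. This formula serves both the upper bound
  and the limit.
\<close>
lemma renyi_gap_eq: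
  assumes b: "b > 1" and \<alpha>: "\<alpha> > 0" and X: "int_random_variable M X"
    and mode: "\<And>n. prob_mass M X n \<le> prob_mass M X m" "0 < prob_mass M X m"
    and T: "((\<lambda>n. gap_fun \<alpha> (prob_mass M X n / prob_mass M X m)) has_sum T) UNIV"
  shows "renyi_entropy b \<alpha> M X - renyi_entropy_infinity b M X
      = ereal (log b (gap_base \<alpha>) + gap_excess \<alpha> (prob_mass M X m * T) / ln b)"
    and "\<alpha> \<noteq> 1 \<Longrightarrow> 0 < 1 + (1 - \<alpha>) * (prob_mass M X m * T)"
proof -
  define P where "P = prob_mass M X"
  define c where "c = P m"
  define \<tau> where "\<tau> = c * T"
  have P_sum: "(P has_sum 1) UNIV" and nonneg: "\<And>n. 0 \<le> P n" and c: "0 < c"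
    using prob_mass_has_sum_1[OF X] mode by (auto simp: P_def c_def)
  have T': "((\<lambda>n. gap_fun \<alpha> (P n / c)) has_sum T) UNIV" using T by (simp add: P_def c_def)
  have "(SUP n. P n) = c"
    using mode by (intro cSup_eq_maximum) (auto simp: P_def c_def)
  then have inf: "renyi_entropy_infinity b M X = ereal (- log b c)"
    by (simp add: renyi_entropy_infinity_def P_def)
  have on_support: "(f has_sum s) {n. P n > 0}"
    if "(f has_sum s) UNIV" "\<And>n. P n = 0 \<Longrightarrow> f n = 0" for f :: "int \<Rightarrow> real" and s
  proof -
    have "f n = 0" if "n \<notin> {n. P n > 0}" for n
      using that nonneg[of n] \<open>\<And>n. P n = 0 \<Longrightarrow> f n = 0\<close> by auto
    then show ?thesis using that(1) has_sum_cong_neutral[of UNIV "{n. P n > 0}" f f s] by auto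
  qed
  have lnb: "ln b > 0" using b by simp
  have "renyi_entropy b \<alpha> M X - renyi_entropy_infinity b M X
      = ereal (log b (gap_base \<alpha>) + gap_excess \<alpha> \<tau> / ln b) \<and> (\<alpha> \<noteq> 1 \<longrightarrow> 0 < 1 + (1 - \<alpha>) * \<tau>)"
  proof (cases "\<alpha> = 1")
    case True
    have "P n * log b (P n) = (ln c * P n + - P n + - (c * gap_fun \<alpha> (P n / c))) * (1 / ln b)" for n
    proof (cases "P n = 0")
      case False
      then have "ln (P n) = ln (P n / c) + ln c" using nonneg[of n] c by (simp add: ln_div)
      then have "P n * log b (P n) = P n * (ln (P n / c) + ln c) / ln b" by (simp add: log_def)
      also have "\<dots> = (ln c * P n + - P n + - (c * gap_fun \<alpha> (P n / c))) * (1 / ln b)"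
        using True c lnb by (simp add: gap_fun_def field_simps)
      finally show ?thesis .
    qed simp
    moreover have "((\<lambda>n. (ln c * P n + - P n + - (c * gap_fun \<alpha> (P n / c))) * (1 / ln b))
        has_sum ((ln c * 1 + - 1 + - (c * T)) * (1 / ln b))) UNIV"
      by (rule has_sum_cmult_left[OF has_sum_add[OF has_sum_add[OF has_sum_cmult_right[OF P_sum]
        has_sum_uminusI[OF P_sum]] has_sum_uminusI[OF has_sum_cmult_right[OF T']]]])
    ultimately have "((\<lambda>n. P n * log b (P n)) has_sum ((ln c - 1 - \<tau>) / ln b)) UNIV"
      by (simp add: \<tau>_def)
    then have hs: "((\<lambda>n. P n * log b (P n)) has_sum ((ln c - 1 - \<tau>) / ln b)) {n. P n > 0}"
      by (rule on_support) simp
    then have "renyi_entropy b \<alpha> M X = ereal (- ((ln c - 1 - \<tau>) / ln b))"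
      unfolding renyi_entropy_def P_def[symmetric] Let_def
      using True has_sum_imp_summable[OF hs] infsumI[OF hs] by simp
    then show ?thesis
      using True inf by (simp add: gap_base_def gap_excess_def log_def diff_divide_distrib)
  next
    case False
    define A where "A = c powr (\<alpha> - 1) * (1 + (1 - \<alpha>) * \<tau>) / \<alpha>"
    have "P n powr \<alpha> = ((1 - \<alpha>) * gap_fun \<alpha> (P n / c) + P n * (1 / c)) * (c powr \<alpha> / \<alpha>)" for n
      using False \<alpha> c nonneg[of n] by (simp add: gap_fun_def powr_divide)
    moreover have "((\<lambda>n. ((1 - \<alpha>) * gap_fun \<alpha> (P n / c) + P n * (1 / c)) * (c powr \<alpha> / \<alpha>))
        has_sum (((1 - \<alpha>) * T + 1 * (1 / c)) * (c powr \<alpha> / \<alpha>))) UNIV"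
      by (rule has_sum_cmult_left[OF has_sum_add[OF has_sum_cmult_right[OF T']
        has_sum_cmult_left[OF P_sum]]])
    moreover have "((1 - \<alpha>) * T + 1 * (1 / c)) * (c powr \<alpha> / \<alpha>) = A"
      using c \<alpha> by (simp add: A_def \<tau>_def powr_diff field_simps)
    ultimately have A_sum: "((\<lambda>n. P n powr \<alpha>) has_sum A) UNIV" by simp
    then have hs: "((\<lambda>n. P n powr \<alpha>) has_sum A) {n. P n > 0}"
      by (rule on_support) simp
    have "0 < c powr \<alpha>" using c by simp
    also have "\<dots> \<le> A"
      using has_sum_mono_neutral[OF has_sum_finite[of "{m}" "\<lambda>n. P n powr \<alpha>"] A_sum] by (simp add: c_def)
    finally have "0 < A" .
    then have pos: "0 < 1 + (1 - \<alpha>) * \<tau>" using \<alpha> c by (simp add: A_def zero_less_mult_iff zero_less_divide_iff)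
    have "ln A = (\<alpha> - 1) * ln c + ln (1 + (1 - \<alpha>) * \<tau>) - ln \<alpha>"
      using pos c \<alpha> by (simp add: A_def ln_div ln_mult ln_powr)
    then have "1 / (1 - \<alpha>) * log b A + log b c = log b (gap_base \<alpha>) + gap_excess \<alpha> \<tau> / ln b"
      using False lnb \<alpha>
      by (simp add: gap_base_def gap_excess_def log_def ln_powr divide_simps) (simp add: algebra_simps)
    moreover have "renyi_entropy b \<alpha> M X = ereal (1 / (1 - \<alpha>) * log b A)"
      unfolding renyi_entropy_def P_def[symmetric] Let_def
      using False has_sum_imp_summable[OF hs] infsumI[OF hs] by simp
    ultimately show ?thesis using inf pos by simp
  qed
  then show "renyi_entropy b \<alpha> M X - renyi_entropy_infinity b M X
      = ereal (log b (gap_base \<alpha>) + gap_excess \<alpha> (prob_mass M X m * T) / ln b)"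
    and "\<alpha> \<noteq> 1 \<Longrightarrow> 0 < 1 + (1 - \<alpha>) * (prob_mass M X m * T)"
    by (auto simp: \<tau>_def c_def P_def)
qed

lemma gap_excess_neg:
  assumes "\<tau> < 0" and "\<alpha> \<noteq> 1 \<Longrightarrow> 0 < 1 + (1 - \<alpha>) * \<tau>"
  shows "gap_excess \<alpha> \<tau> < 0"
proof (cases \<alpha> "1::real" rule: linorder_cases)
  case less
  then have "(1 - \<alpha>) * \<tau> < 0" using assms by (simp add: mult_pos_neg)
  then show ?thesis using less assms by (simp add: gap_excess_def divide_neg_pos ln_less_zero_iff)
next
  case greater
  then have "(1 - \<alpha>) * \<tau> > 0" using assms by (simp add: mult_neg_neg)
  then show ?thesis using greater assms by (simp add: gap_excess_def divide_pos_neg)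
qed (use assms in \<open>simp add: gap_excess_def\<close>)

lemma gap_excess_tendsto:
  assumes "(f \<longlongrightarrow> 0) F"
  shows "((\<lambda>p. gap_excess \<alpha> (f p)) \<longlongrightarrow> 0) F"
proof (cases "\<alpha> = 1")
  case False
  have "((\<lambda>p. ln (1 + (1 - \<alpha>) * f p) / (1 - \<alpha>)) \<longlongrightarrow> ln (1 + (1 - \<alpha>) * 0) / (1 - \<alpha>)) F"
    using assms False by (intro tendsto_intros) auto
  then show ?thesis using False by (simp add: gap_excess_def)
qed (use assms in \<open>simp add: gap_excess_def\<close>)

lemma log_concave_gap_less:
  assumes b: "b > 1" and \<alpha>: "\<alpha> > 0" and X: "log_concave_rv M X"
  shows "renyi_entropy b \<alpha> M X - renyi_entropy_infinity b M X < ereal (log b (gap_base \<alpha>))"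
proof -
  let ?P = "prob_mass M X"
  have rv: "int_random_variable M X" using X by (simp add: log_concave_rv_def)
  have P_sum: "(?P has_sum 1) UNIV" by (rule prob_mass_has_sum_1[OF rv])
  obtain a where a: "?P a > 0"
  proof (rule ccontr)
    assume "\<not> thesis"
    have "?P n = 0" for n
      using that[of n] \<open>\<not> thesis\<close> prob_mass_nonneg[of M X n] by linarith
    then have "?P = (\<lambda>_. 0)" by (rule ext)
    then show False using infsumI[OF P_sum] by simp
  qed
  obtain m where m: "\<And>n. ?P n \<le> ?P m"
    using summable_attains_max[OF has_sum_imp_summable[OF P_sum] prob_mass_nonneg a] by blast
  have m0: "?P m > 0" using m[of a] a by linarith
  have "?P (n - 1) * ?P (n + 1) \<le> (?P n)\<^sup>2" for n
    using X by (simp add: log_concave_rv_def)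
  moreover have "0 < ?P n" if "0 < ?P a" "0 < ?P b" "a \<le> n" "n \<le> b" for a b n
    using X that unfolding log_concave_rv_def by blast
  ultimately obtain T where T: "T < 0" "((\<lambda>n. gap_fun \<alpha> (?P n / ?P m)) has_sum T) UNIV"
    using two_sided_gap[OF \<alpha> prob_mass_nonneg has_sum_imp_summable[OF P_sum] m m0] by blast
  note gap = renyi_gap_eq[OF b \<alpha> rv m m0 T(2)]
  have "gap_excess \<alpha> (?P m * T) < 0"
    using gap(2) T m0 by (intro gap_excess_neg) (auto simp: mult_pos_neg)
  then show ?thesis using gap(1) b by (simp add: divide_neg_pos)
qed

text \<open>
  The masses at the nonnegative integers already add up to \<open>1\<close>, so the others vanish and the left half
  contributes nothing to \<open>T\<close>.
\<close>
lemma geometric_gap_eq: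
  assumes b: "b > 1" and \<alpha>: "\<alpha> > 0" and p: "0 < p" "p < 1" and Z: "geometric_rv p M Z"
  shows "renyi_entropy b \<alpha> M Z - renyi_entropy_infinity b M Z
      = ereal (log b (gap_base \<alpha>) + gap_excess \<alpha> (p * geo_gap \<alpha> (1 - p)) / ln b)"
proof -
  let ?P = "prob_mass M Z"
  have rv: "int_random_variable M Z" and P: "\<And>n. ?P (int n) = p * (1 - p) ^ n"
    using Z by (auto simp: geometric_rv_def)
  have P_sum: "(?P has_sum 1) UNIV" by (rule prob_mass_has_sum_1[OF rv])
  have bij: "bij_betw int UNIV {0..}" by (rule bij_betwI[where g = nat]) auto
  have "(\<lambda>n. p * (1 - p) ^ n) sums (p * (1 / (1 - (1 - p))))"
    using p by (intro sums_mult geometric_sums) auto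
  then have "((\<lambda>n. ?P (int n)) has_sum 1) UNIV"
    using p P by (intro sums_nonneg_imp_has_sum) auto
  then have P_half: "(?P has_sum 1) {0..}" by (simp add: has_sum_reindex_bij_betw[OF bij, of ?P])
  have neg: "?P n = 0" if "n < 0" for n
  proof -
    have "(?P has_sum (1 - 1)) (UNIV - {0..})" by (rule has_sum_Diff[OF P_sum P_half]) simp
    then have "(?P has_sum 0) (UNIV - {0..})" by simp
    moreover have "n \<in> UNIV - {0..}" using that by auto
    ultimately show ?thesis using nonneg_has_sum_le_0D[of ?P "UNIV - {0..}" 0 n] by auto
  qed
  have P0: "?P 0 = p" using P[of 0] by simp
  have max: "?P n \<le> ?P 0" for n
  proof (cases "n < 0")
    case True
    then show ?thesis using neg by simp
  next
    case False
    then show ?thesis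
      using P[of "nat n"] P0 p by (simp add: mult_left_le power_le_one)
  qed
  have "((\<lambda>n. gap_fun \<alpha> ((1 - p) ^ n)) has_sum geo_gap \<alpha> (1 - p)) UNIV"
    using p by (intro sums_gap_fun_imp_has_sum gap_fun_geometric_sums \<alpha> summable_geometric)
      (auto simp: power_le_one)
  then have "((\<lambda>n. gap_fun \<alpha> (?P (int n) / ?P 0)) has_sum geo_gap \<alpha> (1 - p)) UNIV"
    using p by (simp add: P P0)
  then have "((\<lambda>n. gap_fun \<alpha> (?P n / ?P 0)) has_sum geo_gap \<alpha> (1 - p)) {0..}"
    using has_sum_reindex_bij_betw[OF bij, of "\<lambda>n. gap_fun \<alpha> (?P n / ?P 0)"] by simp
  then have "((\<lambda>n. gap_fun \<alpha> (?P n / ?P 0)) has_sum geo_gap \<alpha> (1 - p)) UNIV"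
    using neg by (subst has_sum_cong_neutral[of "{0..}" UNIV]) auto
  from renyi_gap_eq(1)[OF b \<alpha> rv max _ this] show ?thesis using P0 p by simp
qed

section \<open>The bound and its limit for geometric laws\<close>

theorem theorem1p3:
  fixes b \<alpha> :: real
    and M :: "'a measure" and X :: "'a \<Rightarrow> int"
    and N :: "real \<Rightarrow> 'b measure" and Z :: "real \<Rightarrow> 'b \<Rightarrow> int"
  assumes "b > 1"
    and "\<alpha> > 0"
    and "log_concave_rv M X"
    and "\<And>p. 0 < p \<Longrightarrow> p < 1 \<Longrightarrow> geometric_rv p (N p) (Z p)"
  shows "\<exists>L. ((\<lambda>p. renyi_entropy b \<alpha> (N p) (Z p) - renyi_entropy_infinity b (N p) (Z p))
                \<longlongrightarrow> L) (at_right 0)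
           \<and> renyi_entropy b \<alpha> M X - renyi_entropy_infinity b M X < L
           \<and> L = ereal (log b (gap_base \<alpha>))"
proof (intro exI[of _ "ereal (log b (gap_base \<alpha>))"] conjI refl)
  let ?gap = "\<lambda>p. renyi_entropy b \<alpha> (N p) (Z p) - renyi_entropy_infinity b (N p) (Z p)"
  have "((\<lambda>p. log b (gap_base \<alpha>) + gap_excess \<alpha> (p * geo_gap \<alpha> (1 - p)) / ln b)
      \<longlongrightarrow> log b (gap_base \<alpha>) + 0 / ln b) (at_right 0)"
    using assms(1) gap_excess_tendsto[OF geo_gap_tendsto[OF assms(2)]]
    by (intro tendsto_intros) auto
  then have "((\<lambda>p. ereal (log b (gap_base \<alpha>) + gap_excess \<alpha> (p * geo_gap \<alpha> (1 - p)) / ln b))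
      \<longlongrightarrow> ereal (log b (gap_base \<alpha>))) (at_right 0)"
    by simp
  moreover have "\<forall>\<^sub>F p in at_right 0. ?gap p
      = ereal (log b (gap_base \<alpha>) + gap_excess \<alpha> (p * geo_gap \<alpha> (1 - p)) / ln b)"
    unfolding eventually_at_right_field
  proof (intro exI[of _ 1] conjI allI impI)
    fix p :: real
    assume "0 < p" "p < 1"
    then show "?gap p = ereal (log b (gap_base \<alpha>) + gap_excess \<alpha> (p * geo_gap \<alpha> (1 - p)) / ln b)"
      by (intro geometric_gap_eq assms)
  qed simp
  ultimately show "(?gap \<longlongrightarrow> ereal (log b (gap_base \<alpha>))) (at_right 0)"
    by (simp add: tendsto_cong)
qed (rule log_concave_gap_less[OF assms(1-3)])

end
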